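(* Let $W$ be a random variable with $\mathbb P(W>0)=1$, $\mathbb E[W]=1$ and $\mathbb E[W\log_2 W]<1$, let $\rho$ be the random cascade metric on $[0,1]$ built from $W$ (see context), and let $\phi(s):=s-\log_2\mathbb E[W^s]$. Let $K\subset[0,1]$ be a deterministic nonempty set, $\zeta_0$ its Hausdorff dimension with respect to the Euclidean metric, and $\zeta$ its Hausdorff dimension with respect to $\rho$. Then almost surely $\phi(\zeta)\le\zeta_0$.
   Context: For $n\ge 0$ let $\mathcal I_n$ be the set of dyadic intervals $[k2^{-n},(k+1)2^{-n}]$, $k\in\{0,\dots,2^n-1\}$, and $\mathcal I=\bigcup_n\mathcal I_n$. Let $(W_I)_{I\in\mathcal I}$ be i.i.d. copies of $W$. For $x\in[0,1]$ let $I_j(x)$ be the interval of $\mathcal I_j$ containing $x$ (if there are two, the one whose maximum is $x$). Let $\mu_0$ be Lebesgue measure on $[0,1]$ and $\mu_n:=w_n\,\mu_0$ where $w_n(x):=\prod_{j=0}^{n-1}W_{I_j(x)}$. The weak limit $\mu:=\lim_{n\to\infty}\mu_n$ exists almost surely. The random metric is $\rho(x,y):=\mu[x,y]$ for $0\le x\le y\le 1$ (and symmetrically). *)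

theory Defs
  imports "HOL-Probability.Probability"
begin

text \<open>Index of the dyadic interval of generation j containing x (for x in (0,1]
  the one whose right endpoint may be x; for x = 0 the first one).
  Dyadic intervals [k 2^-j, (k+1) 2^-j] are encoded by pairs (j,k) with k < 2^j.\<close>
definition dyadic_index :: "nat \<Rightarrow> real \<Rightarrow> nat" where
  "dyadic_index j x = nat (\<lceil>x * 2 ^ j\<rceil> - 1)"

definition cascade_density ::
    "(nat \<times> nat \<Rightarrow> 'a \<Rightarrow> real) \<Rightarrow> nat \<Rightarrow> 'a \<Rightarrow> real \<Rightarrow> real" where
  "cascade_density Wf n \<omega> x = (\<Prod>j<n. Wf (j, dyadic_index j x) \<omega>)"

definition cascade_limit ::
    "(nat \<times> nat \<Rightarrow> 'a \<Rightarrow> real) \<Rightarrow> 'a \<Rightarrow> real measure \<Rightarrow> bool" where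
  "cascade_limit Wf \<omega> \<nu> \<longleftrightarrow>
     finite_measure \<nu> \<and> sets \<nu> = sets borel \<and> emeasure \<nu> (- {0..1}) = 0 \<and>
     (\<forall>f :: real \<Rightarrow> real. continuous_on {0..1} f \<longrightarrow>
        (\<lambda>n. integral {0..1} (\<lambda>x. f x * cascade_density Wf n \<omega> x))
          \<longlonglongrightarrow> (LINT x:{0..1}|\<nu>. f x))"

definition cascade_metric :: "real measure \<Rightarrow> real \<Rightarrow> real \<Rightarrow> real" where
  "cascade_metric \<nu> x y = measure \<nu> {min x y..max x y}"

definition sdiam :: "(real \<Rightarrow> real \<Rightarrow> real) \<Rightarrow> real set \<Rightarrow> real" where
  "sdiam d U = (if U = {} then 0 else Sup {d x y | x y. x \<in> U \<and> y \<in> U})"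

text \<open>diam(U)^s with the conventions diam(empty)^s = 0 and 0^0 = 1.\<close>
definition cover_cost :: "(real \<Rightarrow> real \<Rightarrow> real) \<Rightarrow> real \<Rightarrow> real set \<Rightarrow> real" where
  "cover_cost d s U = (if U = {} then 0
      else if sdiam d U = 0 then (if s = 0 then 1 else 0) else sdiam d U powr s)"

definition hausdorff_delta ::
    "(real \<Rightarrow> real \<Rightarrow> real) \<Rightarrow> real \<Rightarrow> real \<Rightarrow> real set \<Rightarrow> ennreal" where
  "hausdorff_delta d s \<delta> K =
     (INF U \<in> {U :: nat \<Rightarrow> real set. K \<subseteq> (\<Union>i. U i) \<and>
                  (\<forall>i. U i \<subseteq> {0..1} \<and> sdiam d (U i) \<le> \<delta>)}.
        \<Sum>i. ennreal (cover_cost d s (U i)))"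

definition hausdorff_measure ::
    "(real \<Rightarrow> real \<Rightarrow> real) \<Rightarrow> real \<Rightarrow> real set \<Rightarrow> ennreal" where
  "hausdorff_measure d s K = (SUP \<delta> \<in> {0<..}. hausdorff_delta d s \<delta> K)"

definition hausdorff_dim :: "(real \<Rightarrow> real \<Rightarrow> real) \<Rightarrow> real set \<Rightarrow> ereal" where
  "hausdorff_dim d K = Inf {ereal s | s. 0 \<le> s \<and> hausdorff_measure d s K = 0}"

definition cascade_phi :: "'a measure \<Rightarrow> ('a \<Rightarrow> real) \<Rightarrow> real \<Rightarrow> ereal" where
  "cascade_phi M W s =
     (let m = (\<integral>\<^sup>+ \<omega>. ennreal (W \<omega> powr s) \<partial>M)
      in if m = \<infinity> then -\<infinity> else ereal (s - log 2 (enn2real m)))"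

end

theory Submission
  imports Defs
begin

text \<open>
  Let \<open>s \<in> (0, 1]\<close> and \<open>t < \<phi>(s)\<close> with \<open>H\<^sup>t(K) = 0\<close> for the Euclidean metric. For a dyadic cell \<open>I\<close> of
  generation \<open>m\<close>, independence along branches and concavity of \<open>x \<mapsto> x\<^sup>s\<close> give
  \<open>E[\<mu>\<^sub>n(I)^s] \<le> 2^(-m s) E[W^s]^m \<le> |I|^t\<close> uniformly in \<open>n\<close>. Covering \<open>K\<close> by dyadic cells with
  arbitrarily small \<open>\<Sum> |I|^t\<close> and applying Fatou's lemma shows that \<open>H\<^sup>s(K) = 0\<close> for \<open>\<rho>\<close> almost surely,
  hence \<open>\<zeta> \<le> s\<close>, simultaneously for all such rational \<open>s\<close>. Always \<open>0 \<le> \<zeta> \<le> 1\<close>; if \<open>\<phi>(\<zeta>) > \<zeta>\<^sub>0\<close>, then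
  \<open>\<zeta> > 0\<close> and left continuity of \<open>\<phi>\<close> provides such an \<open>s < \<zeta>\<close>, a contradiction.
\<close>

section \<open>Elementary inequalities\<close>

text \<open>The right-hand side is the tangent at \<open>x = 1\<close> to the concave power
  function; for positive \<open>x\<close> it comes from Young's inequality for \<open>x\<close> and
  \<open>1\<close> with weights \<open>s\<close> and \<open>1 - s\<close>.\<close>

lemma powr_le_affine:
  fixes x s :: real
  assumes "0 \<le> x" "0 \<le> s" "s \<le> 1"
  shows "x powr s \<le> 1 - s + s * x"
proof (cases "x = 0")
  case False
  then show ?thesis
    using Youngs_inequality_0[of s "1 - s" x 1] assms by simp
qed (use assms in auto)

text \<open>After division by the total, each share lies in \<open>[0, 1]\<close>, where an exponent
  \<open>s \<le> 1\<close> can only enlarge it, and the shares add up to 1.\<close>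

lemma powr_sum_le:
  fixes X :: "'i \<Rightarrow> real"
  assumes "finite J" "\<And>i. i \<in> J \<Longrightarrow> 0 \<le> X i" "0 < s" "s \<le> 1"
  shows "(\<Sum>i\<in>J. X i) powr s \<le> (\<Sum>i\<in>J. X i powr s)"
proof (cases "(\<Sum>i\<in>J. X i) = 0")
  case True
  then show ?thesis by (simp add: sum_nonneg)
next
  case False
  define S where "S = (\<Sum>i\<in>J. X i)"
  have S: "S > 0"
    using False sum_nonneg[of J X] assms(2) unfolding S_def by force
  have "1 = (\<Sum>i\<in>J. X i / S)"
    using S by (simp add: S_def flip: sum_divide_distrib)
  also have "\<dots> \<le> (\<Sum>i\<in>J. (X i / S) powr s)"
  proof (rule sum_mono)
    fix i assume i: "i \<in> J"
    have "X i \<le> S" unfolding S_def using i assms by (intro member_le_sum) auto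
    then show "X i / S \<le> (X i / S) powr s"
      using powr_mono'[of s 1 "X i / S"] assms(2)[OF i] assms(3,4) S by simp
  qed
  also have "\<dots> = (\<Sum>i\<in>J. X i powr s) / S powr s"
    using S assms(2) by (simp add: powr_divide flip: sum_divide_distrib)
  finally show ?thesis using S by (simp add: S_def field_simps)
qed

text \<open>For \<open>d > 0\<close> the finest dyadic scale not below \<open>d\<close> is less than
  \<open>2 * d\<close>, whence the factor \<open>2 powr t\<close>. The slack \<open>\<eta>\<close>
  serves \<open>d = 0\<close>, where there is no finest scale and a sufficiently fine one is
  taken.\<close>

lemma exists_dyadic_scale:
  fixes d t \<eta> :: real
  assumes "0 \<le> d" "d \<le> 1" "0 < t" "0 < \<eta>"
  shows "\<exists>m::nat. d \<le> (1/2) ^ m \<and> ((1/2) ^ m) powr t \<le> 2 powr t * d powr t + \<eta>"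
proof (cases "d = 0")
  case True
  have "(\<lambda>m::nat. ((1/2::real) ^ m) powr t) \<longlonglongrightarrow> 0"
    using assms(3) by (intro tendsto_zero_powrI[where b = t] LIMSEQ_power_zero) auto
  then have "\<forall>\<^sub>F m in sequentially. ((1/2::real) ^ m) powr t < \<eta>"
    using assms(4) by (rule order_tendstoD)
  then show ?thesis using True by (auto simp: eventually_sequentially intro: less_imp_le)
next
  case False
  define m where "m = (LEAST m::nat. (1/2) ^ Suc m < d)"
  obtain n :: nat where "(1/2) ^ n < d"
    using real_arch_pow_inv[of d "1/2"] False assms(1) by auto
  moreover from this have "n \<noteq> 0" using assms(2) by (intro notI) auto
  ultimately have "\<exists>m::nat. (1/2) ^ Suc m < d" by (metis not0_implies_Suc)
  then have less: "(1/2) ^ Suc m < d" unfolding m_def by (rule LeastI_ex)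
  have "d \<le> (1/2) ^ m"
  proof (cases m)
    case (Suc k)
    then have "\<not> (1/2) ^ Suc k < d" unfolding m_def by (metis lessI not_less_Least)
    then show ?thesis using Suc by simp
  qed (use assms in simp)
  moreover have "((1/2) ^ m) powr t \<le> (2 * d) powr t"
    using less assms(3) by (intro powr_mono2) auto
  ultimately show ?thesis
    using assms by (intro exI[of _ m]) (auto simp: powr_mult)
qed

section \<open>Dyadic cells\<close>

text \<open>Equality in the first bound occurs at \<open>x = 0\<close>, where \<open>nat\<close>
  sends \<open>-1\<close> to 0; in the second, at right endpoints of cells.\<close>

lemma dyadic_index_bounds:
  assumes "0 \<le> x"
  shows "real (dyadic_index n x) \<le> x * 2 ^ n" "x * 2 ^ n \<le> real (dyadic_index n x) + 1"
proof -
  have "0 \<le> x * 2 ^ n" using assms by simp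
  then show "real (dyadic_index n x) \<le> x * 2 ^ n" "x * 2 ^ n \<le> real (dyadic_index n x) + 1"
    unfolding dyadic_index_def by linarith+
qed

lemma dyadic_index_less:
  assumes "x \<le> 1"
  shows "dyadic_index n x < 2 ^ n"
proof -
  have "x * 2 ^ n \<le> of_int (2 ^ n)" using assms by simp
  then have "\<lceil>x * 2 ^ n\<rceil> \<le> 2 ^ n" by (simp only: ceiling_le_iff)
  then have "\<lceil>x * 2 ^ n\<rceil> - 1 < int (2 ^ n)" by simp
  then have "nat (\<lceil>x * 2 ^ n\<rceil> - 1) < nat (int (2 ^ n))"
    by (simp only: zless_nat_conj) simp
  then show ?thesis unfolding dyadic_index_def by simp
qed

text \<open>Dyadic cells are nested, so going up \<open>n - j\<close> generations is an integer
  division of the index. The work lies in the ceiling convention, since \<open>div\<close> rounds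
  down.\<close>

lemma dyadic_index_coarsen:
  assumes "j \<le> n"
  shows "dyadic_index j x = dyadic_index n x div 2 ^ (n - j)"
proof -
  define N :: int where "N = 2 ^ (n - j)"
  define y where "y = x * 2 ^ n"
  have N: "N > 0" unfolding N_def by simp
  have "(2::real) ^ n = 2 ^ j * of_int N"
    using assms unfolding N_def by (simp del: power_diff flip: power_add)
  then have "x * 2 ^ j = y / of_int N"
    using N unfolding y_def by simp
  \<comment> \<open>The ceiling is minus the floor of the negative, which brings in the division law
    for floors.\<close>
  then have "\<lceil>x * 2 ^ j\<rceil> = - (\<lfloor>- y\<rfloor> div N)"
    using floor_divide_real_eq_div[of N "- y"] N by (simp add: ceiling_def)
  also have "\<dots> = - ((- \<lceil>y\<rceil>) div N)"
    by (simp add: ceiling_def)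
  \<comment> \<open>Rounding a quotient up becomes rounding down with the numerator lowered by 1;
    this matches the offset in \<open>dyadic_index\<close>.\<close>
  also have "\<dots> = (\<lceil>y\<rceil> - 1) div N + 1"
  proof -
    have "(- \<lceil>y\<rceil>) div N = - ((\<lceil>y\<rceil> - 1) div N + 1)"
    proof (rule int_div_pos_eq)
      show "- \<lceil>y\<rceil> = N * (- ((\<lceil>y\<rceil> - 1) div N + 1)) + (N - 1 - (\<lceil>y\<rceil> - 1) mod N)"
        using mult_div_mod_eq[of N "\<lceil>y\<rceil> - 1"] by (simp add: algebra_simps)
    qed (use N pos_mod_bound[of N "\<lceil>y\<rceil> - 1"] pos_mod_sign[of N "\<lceil>y\<rceil> - 1"] in linarith)+
    then show ?thesis by simp
  qed
  finally have "dyadic_index j x = nat ((\<lceil>y\<rceil> - 1) div N)"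
    unfolding dyadic_index_def by simp
  \<comment> \<open>A negative numerator has a negative quotient, and then \<open>nat\<close> makes
    both sides 0.\<close>
  also have "\<dots> = nat (\<lceil>y\<rceil> - 1) div nat N"
  proof (cases "\<lceil>y\<rceil> - 1 \<ge> 0")
    case True
    then show ?thesis by (rule nat_div_distrib)
  next
    case False
    then have "(\<lceil>y\<rceil> - 1) div N < 0" using N pos_imp_zdiv_neg_iff[of N "\<lceil>y\<rceil> - 1"] by linarith
    then show ?thesis using False by simp
  qed
  finally show ?thesis unfolding dyadic_index_def y_def N_def by (simp add: nat_power_eq)
qed

text \<open>The mass that the measure of generation \<open>m + r\<close> gives to the dyadic cell \<open>(m, k)\<close>.\<close>
definition cell_mass :: "(nat \<times> nat \<Rightarrow> 'a \<Rightarrow> real) \<Rightarrow> nat \<Rightarrow> nat \<Rightarrow> nat \<Rightarrow> 'a \<Rightarrow> real" where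
  "cell_mass Wf m k r \<omega> =
     (\<Sum>l<2 ^ r. \<Prod>j<m + r. Wf (j, (k * 2 ^ r + l) div 2 ^ (m + r - j)) \<omega>) / 2 ^ (m + r)"

lemma descendant_less:
  fixes k l m r :: nat
  assumes "k < 2 ^ m" "l < 2 ^ r"
  shows "k * 2 ^ r + l < 2 ^ (m + r)"
proof -
  have "k * 2 ^ r + l < (k + 1) * 2 ^ r" using assms by simp
  also have "\<dots> \<le> 2 ^ m * 2 ^ r" using assms by (intro mult_right_mono) auto
  finally show ?thesis by (simp add: power_add)
qed

lemma ancestor_less:
  fixes i j n :: nat
  assumes "i < 2 ^ n" "j \<le> n"
  shows "i div 2 ^ (n - j) < 2 ^ j"
  using assms by (simp add: less_mult_imp_div_less flip: power_add)

lemma cell_mass_nonneg: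
  assumes pos: "\<And>j i. i < 2 ^ j \<Longrightarrow> 0 < Wf (j, i) \<omega>" and "k < 2 ^ m"
  shows "0 \<le> cell_mass Wf m k r \<omega>"
  unfolding cell_mass_def using assms
  by (intro divide_nonneg_nonneg sum_nonneg prod_nonneg)
     (auto intro!: less_imp_le[OF pos] ancestor_less descendant_less)

text \<open>The density is constant on cells of generation \<open>m + r\<close>. So the integrand
  lies below the step function \<open>g\<close> built from the descendants of \<open>J\<close>,
  whose integral is the right-hand side.\<close>

lemma integral_cascade_density_le:
  fixes f :: "real \<Rightarrow> real"
  assumes pos: "\<And>j i. i < 2 ^ j \<Longrightarrow> 0 < Wf (j, i) \<omega>"
    and J: "J \<subseteq> {..<2 ^ m}"
    and f: "\<And>x. 0 \<le> f x" "\<And>x. f x \<le> 1"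
    and supp: "\<And>x. x \<in> {0..1} \<Longrightarrow> f x \<noteq> 0 \<Longrightarrow> dyadic_index m x \<in> J"
  shows "integral {0..1} (\<lambda>x. f x * cascade_density Wf (m + r) \<omega> x)
           \<le> (\<Sum>k\<in>J. cell_mass Wf m k r \<omega>)"
proof -
  define n where "n = m + r"
  define c where "c i = (\<Prod>j<n. Wf (j, i div 2 ^ (n - j)) \<omega>)" for i :: nat
  define C where "C i = {real i / 2 ^ n..(real i + 1) / 2 ^ n}" for i :: nat
  \<comment> \<open>The cells \<open>C\<close> are closed, so common endpoints may be counted twice;
    this only enlarges \<open>g\<close> and does not affect its integral.\<close>
  define g where "g x = (\<Sum>k\<in>J. \<Sum>l<2 ^ r. if x \<in> C (k * 2 ^ r + l) then c (k * 2 ^ r + l) else 0)" for x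
  have finJ: "finite J" using J finite_subset by blast
  have c_nonneg: "0 \<le> c i" if "i < 2 ^ n" for i
    unfolding c_def using that by (intro prod_nonneg) (auto intro!: less_imp_le[OF pos] ancestor_less)
  have desc: "k * 2 ^ r + l < 2 ^ n" if "k \<in> J" "l < 2 ^ r" for k l
    unfolding n_def using that J by (intro descendant_less) auto
  have g_nonneg: "0 \<le> g x" for x
    unfolding g_def by (intro sum_nonneg) (auto intro!: c_nonneg desc)
  have g_int: "(g has_integral (\<Sum>k\<in>J. cell_mass Wf m k r \<omega>)) {0..1}"
  proof -
    have "((\<lambda>x. if x \<in> C i then c i else 0) has_integral (c i / 2 ^ n)) {0..1}" if "i < 2 ^ n" for i
    proof -
      have sub: "C i \<subseteq> {0..1}"
      proof -
        have "real i + 1 \<le> 2 ^ n" using that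
          by (metis Suc_eq_plus1 Suc_leI of_nat_1 of_nat_add of_nat_le_iff of_nat_numeral of_nat_power)
        then show ?thesis unfolding C_def by (auto simp: field_simps intro: order_trans[rotated])
      qed
      have "((\<lambda>x. c i) has_integral (c i / 2 ^ n)) (C i)"
        using has_integral_const_real[of "c i" "real i / 2 ^ n" "(real i + 1) / 2 ^ n"]
        unfolding C_def by (simp add: field_simps)
      then show ?thesis
        using has_integral_restrict_closed_subinterval[of "\<lambda>x. c i" "c i / 2 ^ n"
          "real i / 2 ^ n" "(real i + 1) / 2 ^ n" 0 1] sub
        unfolding C_def cbox_interval by argo
    qed
    then have "(g has_integral (\<Sum>k\<in>J. \<Sum>l<2 ^ r. c (k * 2 ^ r + l) / 2 ^ n)) {0..1}"
      unfolding g_def using finJ desc by (intro has_integral_sum) auto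
    then show ?thesis unfolding cell_mass_def c_def n_def by (simp add: sum_divide_distrib)
  qed
  have le: "f x * cascade_density Wf n \<omega> x \<le> g x" if x: "x \<in> {0..1}" for x
  proof (cases "f x = 0")
    case False
    define i where "i = dyadic_index n x"
    define k where "k = i div 2 ^ r"
    define l where "l = i mod 2 ^ r"
    have il: "i = k * 2 ^ r + l" unfolding k_def l_def by (rule div_mult_mod_eq[symmetric])
    have l: "l < 2 ^ r" unfolding l_def by simp
    have "k = dyadic_index m x"
      using dyadic_index_coarsen[of m n x] unfolding k_def i_def n_def by simp
    then have k: "k \<in> J" using supp[OF x False] by simp
    have xC: "x \<in> C i"
      using dyadic_index_bounds[of x n] x unfolding C_def i_def by (simp add: field_simps)
    have w: "cascade_density Wf n \<omega> x = c i"
      unfolding cascade_density_def c_def i_def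
      by (intro prod.cong refl) (simp add: dyadic_index_coarsen[OF less_imp_le, of _ n])
    have "f x * c i \<le> c i"
      using mult_right_mono[OF f(2)[of x], of "c i"] c_nonneg[OF desc[OF k l]]
      unfolding il[symmetric] by simp
    also have "\<dots> = (if x \<in> C (k * 2 ^ r + l) then c (k * 2 ^ r + l) else 0)"
      using xC unfolding il[symmetric] by simp
    also have "\<dots> \<le> (\<Sum>l<2 ^ r. if x \<in> C (k * 2 ^ r + l) then c (k * 2 ^ r + l) else 0)"
      using l by (intro member_le_sum[of l]) (auto intro!: c_nonneg desc k)
    also have "\<dots> \<le> g x" unfolding g_def
      using k finJ
      by (intro member_le_sum[of k J "\<lambda>k. \<Sum>l<2 ^ r. if x \<in> C (k * 2 ^ r + l) then c (k * 2 ^ r + l) else 0"] sum_nonneg)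
         (auto intro!: c_nonneg desc)
    finally show ?thesis using w by simp
  qed (simp add: g_nonneg)
  show ?thesis
  proof (cases "(\<lambda>x. f x * cascade_density Wf n \<omega> x) integrable_on {0..1}")
    case True
    then show ?thesis
      using has_integral_le[OF integrable_integral[OF True] g_int] le unfolding n_def by simp
  next
    \<comment> \<open>A non-integrable function has \<open>integral\<close> 0 by convention, which
      is at most the integral of the nonnegative \<open>g\<close>.\<close>
    case False
    then show ?thesis
      using has_integral_nonneg[OF g_int] g_nonneg
      unfolding n_def by (simp add: not_integrable_integral)
  qed
qed

section \<open>Hausdorff measure and dimension\<close>

text \<open>On the reals \<open>Sup\<close> bounds a set only if the set is bounded above, hence the
  first assumption.\<close>

lemma sdiam_upper:
  assumes "bdd_above {d x y |x y. x \<in> U \<and> y \<in> U}" "x \<in> U" "y \<in> U"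
  shows "d x y \<le> sdiam d U"
  unfolding sdiam_def using assms by (auto intro!: cSup_upper)

lemma sdiam_least:
  assumes "\<And>x y. x \<in> U \<Longrightarrow> y \<in> U \<Longrightarrow> d x y \<le> B" "0 \<le> B"
  shows "sdiam d U \<le> B"
proof (cases "U = {}")
  case False
  then have "Sup {d x y |x y. x \<in> U \<and> y \<in> U} \<le> B"
    using assms(1) by (intro cSup_least) blast+
  then show ?thesis using False by (simp add: sdiam_def)
qed (use assms(2) in \<open>simp add: sdiam_def\<close>)

lemma bdd_above_dist:
  fixes U :: "real set"
  assumes "U \<subseteq> {0..1}"
  shows "bdd_above {dist x y |x y. x \<in> U \<and> y \<in> U}"
proof (rule bdd_aboveI[of _ 1])
  fix r assume "r \<in> {dist x y |x y. x \<in> U \<and> y \<in> U}"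
  then obtain x y where "r = dist x y" "x \<in> U" "y \<in> U" by blast
  moreover from this have "x \<in> {0..1}" "y \<in> {0..1}" using assms by auto
  ultimately show "r \<le> 1" by (auto simp: dist_real_def)
qed

lemma bdd_above_cascade_metric:
  assumes "finite_measure \<nu>"
  shows "bdd_above {cascade_metric \<nu> x y |x y. x \<in> U \<and> y \<in> U}"
  unfolding cascade_metric_def
  by (intro bdd_aboveI[of _ "measure \<nu> (space \<nu>)"])
     (auto intro: finite_measure.bounded_measure[OF assms])

lemma sdiam_nonneg:
  assumes "bdd_above {d x y |x y. x \<in> U \<and> y \<in> U}" "\<And>x y. 0 \<le> d x y"
  shows "0 \<le> sdiam d U"
proof (cases "U = {}")
  case False
  then obtain x where "x \<in> U" by auto
  then show ?thesis using order_trans[OF assms(2)[of x x] sdiam_upper[OF assms(1), of x x]] by simp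
qed (simp add: sdiam_def)

text \<open>For positive \<open>s\<close> the case distinctions disappear:
  \<open>0 powr s = 0\<close>, and the empty set has \<open>sdiam\<close> 0.\<close>

lemma cover_cost_eq_powr: "0 < s \<Longrightarrow> cover_cost d s U = sdiam d U powr s"
  unfolding cover_cost_def by (auto simp: sdiam_def)

lemma hausdorff_delta_le_measure: "0 < \<delta> \<Longrightarrow> hausdorff_delta d s \<delta> K \<le> hausdorff_measure d s K"
  unfolding hausdorff_measure_def by (rule SUP_upper) simp

lemma hausdorff_delta_leI:
  assumes "K \<subseteq> (\<Union>i. U i)" "\<And>i. U i \<subseteq> {0..1}" "\<And>i. sdiam d (U i) \<le> \<delta>"
  shows "hausdorff_delta d s \<delta> K \<le> (\<Sum>i. ennreal (cover_cost d s (U i)))"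
  unfolding hausdorff_delta_def using assms by (intro INF_lower) auto

lemma hausdorff_null_coverE:
  assumes "hausdorff_measure d s K = 0" "0 < \<delta>" "0 < \<epsilon>"
  obtains U :: "nat \<Rightarrow> real set"
  where "K \<subseteq> (\<Union>i. U i)" "\<And>i. U i \<subseteq> {0..1}" "\<And>i. sdiam d (U i) \<le> \<delta>"
    "(\<Sum>i. ennreal (cover_cost d s (U i))) < \<epsilon>"
proof -
  have "hausdorff_delta d s \<delta> K < \<epsilon>"
    using hausdorff_delta_le_measure[OF assms(2), of d s K] assms by simp
  then show ?thesis
    unfolding hausdorff_delta_def INF_less_iff using that by auto
qed

lemma hausdorff_measure_eq_0I:
  assumes "\<And>\<delta> \<epsilon> :: real. 0 < \<delta> \<Longrightarrow> 0 < \<epsilon> \<Longrightarrow>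
    \<exists>U :: nat \<Rightarrow> real set. K \<subseteq> (\<Union>i. U i) \<and> (\<forall>i. U i \<subseteq> {0..1} \<and> sdiam d (U i) \<le> \<delta>) \<and>
      (\<Sum>i. ennreal (cover_cost d s (U i))) \<le> ennreal \<epsilon>"
  shows "hausdorff_measure d s K = 0"
proof -
  have "hausdorff_delta d s \<delta> K = 0" if \<delta>: "0 < \<delta>" for \<delta>
  proof -
    have "hausdorff_delta d s \<delta> K \<le> 0 + ennreal \<epsilon>" if \<epsilon>: "0 < \<epsilon>" for \<epsilon>
    proof -
      obtain U :: "nat \<Rightarrow> real set" where "K \<subseteq> (\<Union>i. U i)" "\<And>i. U i \<subseteq> {0..1}"
        "\<And>i. sdiam d (U i) \<le> \<delta>" "(\<Sum>i. ennreal (cover_cost d s (U i))) \<le> ennreal \<epsilon>"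
        using assms[OF \<delta> \<epsilon>] by blast
      then show ?thesis by (simp add: order_trans[OF hausdorff_delta_leI])
    qed
    then have "hausdorff_delta d s \<delta> K \<le> 0" by (rule ennreal_le_epsilon)
    then show ?thesis by simp
  qed
  then have "hausdorff_measure d s K \<le> 0"
    unfolding hausdorff_measure_def by (intro SUP_least) simp
  then show ?thesis by simp
qed

lemma hausdorff_dim_le:
  assumes "0 \<le> s" "hausdorff_measure d s K = 0"
  shows "hausdorff_dim d K \<le> ereal s"
  unfolding hausdorff_dim_def using assms by (intro Inf_lower) auto

text \<open>With exponent 0 every nonempty member of a cover costs 1. This later excludes
  \<open>t = 0\<close>.\<close>

lemma hausdorff_measure_zero_pos:
  assumes "K \<noteq> {}"
  shows "hausdorff_measure d 0 K \<noteq> 0"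
proof
  assume "hausdorff_measure d 0 K = 0"
  then obtain U :: "nat \<Rightarrow> real set" where U: "K \<subseteq> (\<Union>i. U i)"
    and less: "(\<Sum>i. ennreal (cover_cost d 0 (U i))) < 1"
    by (rule hausdorff_null_coverE[of _ _ _ 1 1]) auto
  obtain i where "U i \<noteq> {}" using U assms by blast
  then have "1 = ennreal (cover_cost d 0 (U i))" unfolding cover_cost_def by simp
  also have "\<dots> = (\<Sum>i\<in>{i}. ennreal (cover_cost d 0 (U i)))" by simp
  also have "\<dots> \<le> (\<Sum>i. ennreal (cover_cost d 0 (U i)))"
    by (intro sum_le_suminf) auto
  finally show False using less by simp
qed

text \<open>\<open>cascade_metric \<nu> x x\<close> is the mass of \<open>{x}\<close>, so an atom
  lies in no set of smaller diameter and fine covers do not exist, whatever \<open>s\<close>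
  is.\<close>

lemma null_hausdorff_measure_no_atoms:
  assumes "hausdorff_measure (cascade_metric \<nu>) s K = 0" "x \<in> K" "finite_measure \<nu>"
  shows "measure \<nu> {x} = 0"
proof (rule ccontr)
  assume "measure \<nu> {x} \<noteq> 0"
  then have pos: "0 < measure \<nu> {x} / 2" by (simp add: zero_less_measure_iff)
  obtain U :: "nat \<Rightarrow> real set" where U: "K \<subseteq> (\<Union>i. U i)"
    and small: "\<And>i. sdiam (cascade_metric \<nu>) (U i) \<le> measure \<nu> {x} / 2"
    by (rule hausdorff_null_coverE[OF assms(1) pos, of 1]) auto
  obtain i where "x \<in> U i" using U assms(2) by auto
  then have "measure \<nu> {x} \<le> sdiam (cascade_metric \<nu>) (U i)"
    using sdiam_upper[OF bdd_above_cascade_metric[OF assms(3)], of x "U i" x]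
    by (simp add: cascade_metric_def[of \<nu> x x])
  then show False using small[of i] pos by simp
qed

text \<open>Off the atoms of \<open>\<nu>\<close>, the level sets of its distribution function sampled at spacing
  \<open>\<delta>\<close> have diameter at most \<open>\<delta>\<close>, and about \<open>1/\<delta>\<close> of them suffice.\<close>
lemma hausdorff_measure_cascade_metric_null:
  assumes fin: "finite_measure \<nu>" and sets: "sets \<nu> = sets borel"
    and atoms: "\<And>x. x \<in> K \<Longrightarrow> measure \<nu> {x} = 0"
    and K: "K \<subseteq> {0..1}" and s: "1 < s"
  shows "hausdorff_measure (cascade_metric \<nu>) s K = 0"
proof (rule hausdorff_measure_eq_0I)
  fix \<delta> \<epsilon> :: real assume "0 < \<delta>" "0 < \<epsilon>"
  interpret finite_measure \<nu> by (rule fin)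
  define T where "T = measure \<nu> (space \<nu>)"
  \<comment> \<open>The expression is \<open>(T / e + 1) * e powr s\<close>, a bound for the cost of
    at most \<open>T / e + 1\<close> sets of diameter at most \<open>e\<close>. It vanishes in the
    limit because \<open>s > 1\<close>.\<close>
  have "((\<lambda>e. T * e powr (s - 1) + e powr s) \<longlongrightarrow> T * 0 powr (s - 1) + 0 powr s) (at_right 0)"
    using s by (intro tendsto_intros) (auto simp: eventually_at_right_less intro!: eventually_at_rightI[of 0 1])
  then have "\<forall>\<^sub>F e in at_right 0. T * e powr (s - 1) + e powr s < \<epsilon>"
    using \<open>0 < \<epsilon>\<close> by (intro order_tendstoD) auto
  moreover have "\<forall>\<^sub>F e in at_right 0. e \<in> {0<..<\<delta>}"
    using \<open>0 < \<delta>\<close> by (rule eventually_at_right_real)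
  ultimately have "\<forall>\<^sub>F e in at_right 0. e \<in> {0<..<\<delta>} \<and> T * e powr (s - 1) + e powr s < \<epsilon>"
    by eventually_elim auto
  then obtain e where e: "0 < e" "e < \<delta>" and cost: "T * e powr (s - 1) + e powr s < \<epsilon>"
    using eventually_happens[of _ "at_right (0::real)"] by (auto simp: trivial_limit_at_right_real)
  define F where "F x = measure \<nu> {..x}" for x
  define U where "U i = {x \<in> K. nat \<lfloor>F x / e\<rfloor> = i}" for i
  define N where "N = nat \<lfloor>T / e\<rfloor>"
  have F: "0 \<le> F x" "F x \<le> T" for x unfolding F_def T_def by (auto intro: bounded_measure)
  have "0 \<le> T" unfolding T_def by simp
  have incr: "cascade_metric \<nu> x y \<le> e" if "x \<in> U i" "y \<in> U i" "x \<le> y" for i x y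
  proof -
    \<comment> \<open>Increments of \<open>F\<close> see only the half-open interval; the left
      endpoint lies in \<open>K\<close> and carries no mass.\<close>
    have "{x..y} = {x} \<union> {x<..y}" using that by auto
    then have "measure \<nu> {x..y} = measure \<nu> {x} + measure \<nu> {x<..y}"
      using sets by (simp only:) (intro finite_measure_Union, auto)
    moreover have "{..y} = {..x} \<union> {x<..y}" using that by auto
    then have "F y = F x + measure \<nu> {x<..y}"
      unfolding F_def using sets by (subst finite_measure_Union[symmetric]) auto
    moreover have "measure \<nu> {x} = 0" using that atoms unfolding U_def by auto
    moreover have "F y - F x \<le> e"
    proof -
      have "nat \<lfloor>F x / e\<rfloor> = nat \<lfloor>F y / e\<rfloor>" using that unfolding U_def by auto
      moreover have "0 \<le> F x / e" "0 \<le> F y / e" using F e by auto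
      ultimately have "F y / e - F x / e \<le> 1" by linarith
      then show ?thesis using e by (simp add: field_simps)
    qed
    ultimately show ?thesis using that by (simp add: cascade_metric_def)
  qed
  have diam: "sdiam (cascade_metric \<nu>) (U i) \<le> e" for i
  proof (rule sdiam_least)
    fix x y assume "x \<in> U i" "y \<in> U i"
    then show "cascade_metric \<nu> x y \<le> e"
      using incr[of x i y] incr[of y i x]
      by (cases "x \<le> y") (auto simp: cascade_metric_def min.commute max.commute)
  qed (use e in auto)
  have costU: "cover_cost (cascade_metric \<nu>) s (U i) \<le> e powr s" for i
  proof -
    have "0 \<le> sdiam (cascade_metric \<nu>) (U i)"
      by (intro sdiam_nonneg bdd_above_cascade_metric fin) (simp add: cascade_metric_def)
    then show ?thesis
      using s diam by (simp add: cover_cost_eq_powr powr_mono2)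
  qed
  have empty: "U i = {}" if "i \<notin> {..N}" for i
  proof -
    have "nat \<lfloor>F x / e\<rfloor> \<le> N" for x
      unfolding N_def using F e by (intro nat_mono floor_mono divide_right_mono) auto
    then show ?thesis using that unfolding U_def by auto
  qed
  have "(\<Sum>i. ennreal (cover_cost (cascade_metric \<nu>) s (U i)))
      = (\<Sum>i\<le>N. ennreal (cover_cost (cascade_metric \<nu>) s (U i)))"
    by (rule suminf_finite) (auto simp: empty cover_cost_def)
  also have "\<dots> \<le> (\<Sum>i\<le>N. ennreal (e powr s))"
    by (intro sum_mono ennreal_leI costU)
  also have "\<dots> = ennreal ((real N + 1) * e powr s)"
    by (simp add: ennreal_mult' ennreal_of_nat_eq_real_of_nat add.commute)
  also have "\<dots> \<le> ennreal \<epsilon>"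
  proof (rule ennreal_leI)
    have "real N \<le> T / e" unfolding N_def using \<open>0 \<le> T\<close> e by simp
    then have "(real N + 1) * e powr s \<le> (T / e + 1) * e powr s"
      by (intro mult_right_mono) auto
    also have "\<dots> = T * e powr (s - 1) + e powr s"
      using e by (simp add: powr_diff field_simps)
    finally show "(real N + 1) * e powr s \<le> \<epsilon>" using cost by simp
  qed
  finally have "(\<Sum>i. ennreal (cover_cost (cascade_metric \<nu>) s (U i))) \<le> ennreal \<epsilon>" .
  moreover have "K \<subseteq> (\<Union>i. U i)" "\<And>i. U i \<subseteq> {0..1}" using K unfolding U_def by auto
  ultimately show "\<exists>U :: nat \<Rightarrow> real set. K \<subseteq> (\<Union>i. U i) \<and>
      (\<forall>i. U i \<subseteq> {0..1} \<and> sdiam (cascade_metric \<nu>) (U i) \<le> \<delta>) \<and>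
      (\<Sum>i. ennreal (cover_cost (cascade_metric \<nu>) s (U i))) \<le> ennreal \<epsilon>"
    using order_trans[OF diam less_imp_le[OF e(2)]] by (intro exI[of _ U]) auto
qed

text \<open>An atom in \<open>K\<close> would make the dimension infinite, as the infimum of the
  empty set. A real \<open>\<zeta>\<close> therefore excludes atoms in \<open>K\<close>, and then
  every exponent above 1 gives measure zero.\<close>

lemma hausdorff_dim_bounds:
  assumes "finite_measure \<nu>" "sets \<nu> = sets borel" "K \<subseteq> {0..1}"
    and \<zeta>: "hausdorff_dim (cascade_metric \<nu>) K = ereal \<zeta>"
  shows "0 \<le> \<zeta>" "\<zeta> \<le> 1"
proof -
  have "0 \<le> hausdorff_dim (cascade_metric \<nu>) K"
    unfolding hausdorff_dim_def by (rule Inf_greatest) auto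
  then show "0 \<le> \<zeta>" using \<zeta> by simp
  have "\<exists>s. hausdorff_measure (cascade_metric \<nu>) s K = 0"
  proof (rule ccontr)
    assume "\<not> ?thesis"
    then have "hausdorff_dim (cascade_metric \<nu>) K = \<infinity>"
      unfolding hausdorff_dim_def by (simp add: top_ereal_def)
    then show False using \<zeta> by simp
  qed
  then obtain s0 where "hausdorff_measure (cascade_metric \<nu>) s0 K = 0" ..
  then have "measure \<nu> {x} = 0" if "x \<in> K" for x
    using null_hausdorff_measure_no_atoms that assms(1) by blast
  then have "hausdorff_measure (cascade_metric \<nu>) s K = 0" if "1 < s" for s
    using assms(1-3) that by (intro hausdorff_measure_cascade_metric_null)
  then have "\<zeta> \<le> s" if "1 < s" for s
    using hausdorff_dim_le[of s "cascade_metric \<nu>" K] \<zeta> that by simp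
  then show "\<zeta> \<le> 1" by (rule dense_ge)
qed

section \<open>Diameters in the cascade metric versus masses of dyadic cells\<close>

text \<open>A set of diameter at most \<open>2^(-m)\<close> meeting the cell \<open>k\<close> lies in the closed cells \<open>k - 1, k, k + 1\<close>;
  the extra cell on each side leaves room for a continuous cutoff function.\<close>
definition neighbours :: "nat \<Rightarrow> nat \<Rightarrow> nat set" where
  "neighbours m k = {i. i < 2 ^ m \<and> i \<le> k + 2 \<and> k \<le> i + 2}"

lemma finite_neighbours [simp]: "finite (neighbours m k)"
  unfolding neighbours_def by (rule finite_subset[of _ "{..<2 ^ m}"]) auto

lemma card_neighbours_le: "card (neighbours m k) \<le> 5"
proof -
  have "card (neighbours m k) \<le> card {k - 2..k + 2}"
    unfolding neighbours_def by (intro card_mono) auto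
  also have "\<dots> \<le> 5" by simp
  finally show ?thesis .
qed

text \<open>Weak convergence is tested against a continuous cutoff that is 1 around \<open>U\<close>
  and supported near the neighbouring cells. Subadditivity of the power then separates the cells,
  and the \<open>liminf\<close> prepares for Fatou's lemma.\<close>

lemma sdiam_cascade_metric_powr_le:
  assumes lim: "cascade_limit Wf \<omega> \<nu>"
    and pos: "\<And>j i. i < 2 ^ j \<Longrightarrow> 0 < Wf (j, i) \<omega>"
    and U: "U \<subseteq> {0..1}" "\<And>x. x \<in> U \<Longrightarrow> \<bar>x * 2 ^ m - real k - 1/2\<bar> \<le> 3/2"
    and s: "0 < s" "s \<le> 1"
  shows "ennreal (sdiam (cascade_metric \<nu>) U powr s)
    \<le> liminf (\<lambda>r. \<Sum>i\<in>neighbours m k. ennreal (cell_mass Wf m i r \<omega> powr s))"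
proof -
  interpret finite_measure \<nu> using lim unfolding cascade_limit_def by simp
  have sets: "sets \<nu> = sets borel" using lim unfolding cascade_limit_def by simp
  \<comment> \<open>In units of a cell, \<open>f\<close> is 1 up to distance \<open>3/2\<close> from
    the centre of cell \<open>k\<close> and 0 from distance \<open>5/2\<close> on.\<close>
  define f where "f x = max 0 (min 1 (5/2 - \<bar>x * 2 ^ m - real k - 1/2\<bar>))" for x :: real
  define D where "D = (LINT x:{0..1}|\<nu>. f x)"
  define a where "a n = integral {0..1} (\<lambda>x. f x * cascade_density Wf n \<omega> x)" for n
  have f01: "0 \<le> f x" "f x \<le> 1" for x unfolding f_def by auto
  have fcont: "continuous_on A f" for A unfolding f_def by (intro continuous_intros)
  have aD: "a \<longlonglongrightarrow> D"
    using lim fcont unfolding cascade_limit_def a_def D_def by auto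
  have fmeas[measurable]: "f \<in> borel_measurable \<nu>"
    using borel_measurable_continuous_onI[OF fcont] sets by (simp cong: measurable_cong_sets)
  have [measurable]: "{a..b} \<in> sets \<nu>" for a b :: real using sets by simp
  have D0: "0 \<le> D"
    unfolding D_def set_lebesgue_integral_def using f01 by (intro integral_nonneg_AE) auto
  have metric_le: "cascade_metric \<nu> x y \<le> D" if "x \<in> U" "y \<in> U" for x y
  proof -
    let ?A = "{min x y..max x y}"
    \<comment> \<open>The condition on the points of \<open>U\<close> is convex, so it passes to
      everything between \<open>x\<close> and \<open>y\<close>, where \<open>f\<close> is therefore
      1.\<close>
    have A: "indicator ?A z \<le> indicator {0..1} z * f z" for z :: real
    proof (cases "z \<in> ?A")
      case True
      have "z \<in> {0..1}" using True U(1) that by (auto simp: min_def max_def split: if_splits)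
      consider "x \<le> z" "z \<le> y" | "y \<le> z" "z \<le> x"
        using True by (auto simp: min_def max_def split: if_splits)
      then consider "x * 2 ^ m \<le> z * 2 ^ m" "z * 2 ^ m \<le> y * 2 ^ m"
        | "y * 2 ^ m \<le> z * 2 ^ m" "z * 2 ^ m \<le> x * 2 ^ m"
        by cases auto
      then have "\<bar>z * 2 ^ m - real k - 1/2\<bar> \<le> 3/2"
        using U(2)[OF that(1)] U(2)[OF that(2)] by cases linarith+
      then have "f z = 1" unfolding f_def by simp
      then show ?thesis using True \<open>z \<in> {0..1}\<close> by simp
    qed (simp add: f01)
    have "cascade_metric \<nu> x y = (\<integral>z. indicator ?A z \<partial>\<nu>)"
      unfolding cascade_metric_def by simp
    also have "\<dots> \<le> (\<integral>z. indicator {0..1} z * f z \<partial>\<nu>)"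
    proof (rule integral_mono)
      show "integrable \<nu> (\<lambda>z. indicator {0..1} z * f z)"
        using f01 by (intro integrable_const_bound[of _ 1] AE_I2 borel_measurable_times
          borel_measurable_indicator fmeas) (auto split: split_indicator)
    qed (use A in \<open>auto simp: emeasure_eq_measure\<close>)
    also have "\<dots> = D" unfolding D_def set_lebesgue_integral_def by simp
    finally show ?thesis .
  qed
  have diam: "sdiam (cascade_metric \<nu>) U \<le> D" by (rule sdiam_least) (auto simp: metric_le D0)
  have "0 \<le> sdiam (cascade_metric \<nu>) U"
    by (intro sdiam_nonneg bdd_above_cascade_metric) (unfold_locales, simp add: cascade_metric_def)
  then have "ennreal (sdiam (cascade_metric \<nu>) U powr s) \<le> ennreal (D powr s)"
    using diam s by (intro ennreal_leI powr_mono2) auto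
  \<comment> \<open>The shift by \<open>m\<close> reaches generation \<open>m + r\<close>. The
    \<open>max 0\<close> provides a nonnegative base for \<open>powr\<close> and leaves the limit
    \<open>D \<ge> 0\<close> unchanged.\<close>
  also have "\<dots> = liminf (\<lambda>r. ennreal (max 0 (a (r + m)) powr s))"
  proof (rule lim_imp_Liminf[symmetric])
    have "(\<lambda>r. max 0 (a (r + m))) \<longlonglongrightarrow> max 0 D"
      by (intro tendsto_intros LIMSEQ_ignore_initial_segment aD)
    then have "(\<lambda>r. max 0 (a (r + m)) powr s) \<longlonglongrightarrow> D powr s"
      using D0 s by (intro tendsto_powr') auto
    then show "(\<lambda>r. ennreal (max 0 (a (r + m)) powr s)) \<longlonglongrightarrow> ennreal (D powr s)"
      by (intro tendsto_ennrealI)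
  qed simp
  also have "\<dots> \<le> liminf (\<lambda>r. \<Sum>i\<in>neighbours m k. ennreal (cell_mass Wf m i r \<omega> powr s))"
  proof (intro Liminf_mono always_eventually allI)
    fix r
    have nonneg: "0 \<le> cell_mass Wf m i r \<omega>" if "i \<in> neighbours m k" for i
      using that cell_mass_nonneg[of Wf \<omega> i m r] pos unfolding neighbours_def by auto
    have "a (r + m) \<le> (\<Sum>i\<in>neighbours m k. cell_mass Wf m i r \<omega>)"
      unfolding a_def add.commute[of r m]
    proof (rule integral_cascade_density_le)
      fix x :: real assume x: "x \<in> {0..1}" and "f x \<noteq> 0"
      then have "\<bar>x * 2 ^ m - real k - 1/2\<bar> < 5/2" unfolding f_def by (auto simp: max_def min_def split: if_splits)
      \<comment> \<open>Strictness comes from \<open>f\<close> vanishing at distance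
        \<open>5/2\<close>; for integers, a difference below 3 is at most 2.\<close>
      then have "real (dyadic_index m x) < real k + 3" "real k < real (dyadic_index m x) + 3"
        using dyadic_index_bounds[of x m] x unfolding atLeastAtMost_iff by linarith+
      then show "dyadic_index m x \<in> neighbours m k"
        using dyadic_index_less[of x m] x unfolding neighbours_def by auto
    qed (use f01 pos in \<open>auto simp: neighbours_def\<close>)
    then have "max 0 (a (r + m)) powr s \<le> (\<Sum>i\<in>neighbours m k. cell_mass Wf m i r \<omega>) powr s"
      using s nonneg by (intro powr_mono2) (auto intro: sum_nonneg)
    also have "\<dots> \<le> (\<Sum>i\<in>neighbours m k. cell_mass Wf m i r \<omega> powr s)"
      using s nonneg by (intro powr_sum_le) auto
    finally show "ennreal (max 0 (a (r + m)) powr s)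
        \<le> (\<Sum>i\<in>neighbours m k. ennreal (cell_mass Wf m i r \<omega> powr s))"
      by (subst sum_ennreal) (auto intro: ennreal_leI)
  qed
  finally show ?thesis .
qed

text \<open>Let \<open>k\<close> be the index of some point \<open>y\<close> of \<open>U\<close>. In
  units of a cell, \<open>y\<close> is within \<open>1/2\<close> of the centre of cell
  \<open>k\<close> and the other points are within 1 of \<open>y\<close>, which gives
  \<open>3/2\<close>.\<close>

lemma exists_dyadic_location:
  fixes U :: "real set"
  assumes U: "U \<subseteq> {0..1}" and t: "0 < t" and \<eta>: "0 < \<eta>"
  shows "\<exists>m k. k < 2 ^ m \<and> (\<forall>x\<in>U. \<bar>x * 2 ^ m - real k - 1/2\<bar> \<le> 3/2) \<and>
           ((1/2) ^ m) powr t \<le> 2 powr t * cover_cost dist t U + \<eta>"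
proof -
  let ?d = "sdiam dist U"
  have "0 \<le> ?d" by (rule sdiam_nonneg[OF bdd_above_dist[OF U]]) simp
  moreover have "?d \<le> 1"
  proof (rule sdiam_least)
    fix x y assume "x \<in> U" "y \<in> U"
    then have "x \<in> {0..1}" "y \<in> {0..1}" using U by auto
    then show "dist x y \<le> 1" by (auto simp: dist_real_def)
  qed simp
  ultimately obtain m where m: "?d \<le> (1/2) ^ m"
    and cost: "((1/2) ^ m) powr t \<le> 2 powr t * ?d powr t + \<eta>"
    using exists_dyadic_scale[OF _ _ t \<eta>, of ?d] by blast
  have "\<exists>k<2 ^ m. \<forall>x\<in>U. \<bar>x * 2 ^ m - real k - 1/2\<bar> \<le> 3/2"
  proof (cases "U = {}")
    case True
    then show ?thesis by (intro exI[of _ 0]) simp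
  next
    case False
    then obtain y where y: "y \<in> U" by auto
    show ?thesis
    proof (intro exI[of _ "dyadic_index m y"] conjI ballI)
      have y01: "0 \<le> y" "y \<le> 1" using y U by auto
      show "dyadic_index m y < 2 ^ m" using dyadic_index_less y01 by simp
      fix x assume "x \<in> U"
      then have "\<bar>x - y\<bar> \<le> (1/2) ^ m"
        using sdiam_upper[OF bdd_above_dist[OF U], of x y] y m by (simp add: dist_real_def[of x y])
      then have "\<bar>x - y\<bar> * 2 ^ m \<le> (1/2) ^ m * 2 ^ m" by (intro mult_right_mono) auto
      then have "\<bar>x * 2 ^ m - y * 2 ^ m\<bar> \<le> 1"
        by (simp add: power_one_over abs_mult flip: left_diff_distrib)
      then show "\<bar>x * 2 ^ m - real (dyadic_index m y) - 1/2\<bar> \<le> 3/2"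
        using dyadic_index_bounds[OF y01(1), of m] by linarith
    qed
  qed
  then show ?thesis using cost t by (auto simp: cover_cost_eq_powr)
qed

section \<open>Moments of the cascade\<close>

locale mandelbrot_cascade = prob_space M for M :: "'a measure" +
  fixes W :: "'a \<Rightarrow> real" and Wf :: "nat \<times> nat \<Rightarrow> 'a \<Rightarrow> real"
  assumes W_measurable [measurable]: "W \<in> borel_measurable M"
    and indep: "indep_vars (\<lambda>_. borel) Wf {(n, k). k < 2 ^ n}"
    and distr_eq: "\<And>n k. k < 2 ^ n \<Longrightarrow> distr M borel (Wf (n, k)) = distr M borel W"
    and W_pos: "AE \<omega> in M. W \<omega> > 0"
    and W_integrable: "integrable M W" and W_mean: "(\<integral>\<omega>. W \<omega> \<partial>M) = 1"
begin

lemma Wf_measurable: "k < 2 ^ n \<Longrightarrow> Wf (n, k) \<in> borel_measurable M"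
  using indep unfolding indep_vars_def2 by auto

lemma nn_integral_Wf:
  assumes "k < 2 ^ n" and g: "g \<in> borel_measurable borel"
  shows "(\<integral>\<^sup>+\<omega>. g (Wf (n, k) \<omega>) \<partial>M) = (\<integral>\<^sup>+\<omega>. g (W \<omega>) \<partial>M)"
  using nn_integral_distr[OF Wf_measurable[OF assms(1)], of g] nn_integral_distr[of W M borel g]
    distr_eq[OF assms(1)] g by simp

lemma AE_Wf_pos: "AE \<omega> in M. \<forall>n k. k < 2 ^ n \<longrightarrow> 0 < Wf (n, k) \<omega>"
proof (intro AE_all_countable[THEN iffD2] allI)
  fix n k :: nat
  show "AE \<omega> in M. k < 2 ^ n \<longrightarrow> 0 < Wf (n, k) \<omega>"
  proof (cases "k < 2 ^ n")
    case True
    have "AE x in distr M borel W. 0 < x" using W_pos by (subst AE_distr_iff) auto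
    then have "AE x in distr M borel (Wf (n, k)). 0 < x" unfolding distr_eq[OF True] .
    then show ?thesis using True
      by (subst (asm) AE_distr_iff) (auto intro: Wf_measurable)
  qed simp
qed

text \<open>The cells of a path have distinct generations, so their weights are independent. The
  function may vary with the generation, so that a power can be used above a cell and the identity
  inside it.\<close>

lemma nn_integral_prod_path:
  fixes g :: "nat \<Rightarrow> real \<Rightarrow> ennreal"
  assumes p: "\<And>j. j < n \<Longrightarrow> p j < 2 ^ j" and g: "\<And>j. g j \<in> borel_measurable borel"
  shows "(\<integral>\<^sup>+\<omega>. (\<Prod>j<n. g j (Wf (j, p j) \<omega>)) \<partial>M) = (\<Prod>j<n. \<integral>\<^sup>+\<omega>. g j (W \<omega>) \<partial>M)"
proof -
  define I where "I = (\<lambda>j. (j, p j)) ` {..<n}"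
  have inj: "inj_on (\<lambda>j. (j, p j)) {..<n}" by (auto intro: inj_onI)
  have "indep_vars (\<lambda>_. borel) Wf I"
    using p by (intro indep_vars_subset[OF indep]) (auto simp: I_def)
  then have "indep_vars (\<lambda>_. borel) (\<lambda>i \<omega>. g (fst i) (Wf i \<omega>)) I"
    by (rule indep_vars_compose2) (rule g)
  then have "(\<integral>\<^sup>+\<omega>. (\<Prod>i\<in>I. g (fst i) (Wf i \<omega>)) \<partial>M) = (\<Prod>i\<in>I. \<integral>\<^sup>+\<omega>. g (fst i) (Wf i \<omega>) \<partial>M)"
    by (intro indep_vars_nn_integral) (auto simp: I_def)
  also have "\<dots> = (\<Prod>j<n. \<integral>\<^sup>+\<omega>. g j (Wf (j, p j) \<omega>) \<partial>M)"
    unfolding I_def by (simp add: prod.reindex[OF inj])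
  also have "\<dots> = (\<Prod>j<n. \<integral>\<^sup>+\<omega>. g j (W \<omega>) \<partial>M)"
    using p g by (intro prod.cong refl nn_integral_Wf) auto
  finally show ?thesis unfolding I_def by (simp add: prod.reindex[OF inj])
qed

lemma cell_mass_measurable:
  assumes "k < 2 ^ m"
  shows "cell_mass Wf m k r \<in> borel_measurable M"
proof -
  have "(k * 2 ^ r + l) div 2 ^ (m + r - j) < 2 ^ j" if "l < 2 ^ r" "j < m + r" for l j
    using that assms by (intro ancestor_less descendant_less) auto
  then show ?thesis
    unfolding cell_mass_def
    by (intro borel_measurable_divide borel_measurable_sum borel_measurable_prod Wf_measurable) auto
qed

text \<open>The mass is \<open>(1/2) ^ m * A * avg\<close>, where \<open>A\<close> collects the
  generations below \<open>m\<close> and \<open>avg\<close> averages over the \<open>2 ^ r\<close>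
  descendants. The tangent bound for \<open>avg powr s\<close> leaves terms \<open>P\<close> and
  \<open>Q l\<close> of equal expectation, so the estimate is uniform in \<open>r\<close>.\<close>

lemma nn_integral_cell_mass_powr_le:
  assumes k: "k < 2 ^ m" and s: "0 < s" "s \<le> 1"
  shows "(\<integral>\<^sup>+\<omega>. ennreal (cell_mass Wf m k r \<omega> powr s) \<partial>M)
    \<le> ennreal (((1/2) ^ m) powr s) * (\<integral>\<^sup>+\<omega>. ennreal (W \<omega> powr s) \<partial>M) ^ m"
proof -
  define p where "p l j = (k * 2 ^ r + l) div 2 ^ (m + r - j)" for l j :: nat
  define c where "c = ((1/2::real) ^ m) powr s"
  define \<mu> where "\<mu> = (\<integral>\<^sup>+\<omega>. ennreal (W \<omega> powr s) \<partial>M)"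
  define G where "G j w = (if j < m then ennreal (w powr s) else ennreal w)" for j :: nat and w :: real
  have p_less: "p l j < 2 ^ j" if "l < 2 ^ r" "j \<le> m + r" for l j
    unfolding p_def using that k by (intro ancestor_less descendant_less) auto
  \<comment> \<open>For generations below \<open>m\<close> the divisor is a multiple of
    \<open>2 ^ r\<close>, and dividing by \<open>2 ^ r\<close> discards \<open>l\<close>.\<close>
  have p_anc: "p l j = p 0 j" if "l < 2 ^ r" "j < m" for l j
  proof -
    have "(2::nat) ^ (m + r - j) = 2 ^ r * 2 ^ (m - j)" using that by (simp flip: power_add)
    then show ?thesis using that unfolding p_def by (simp add: div_mult2_eq)
  qed
  have G: "G j \<in> borel_measurable borel" for j unfolding G_def by simp
  have W1: "(\<integral>\<^sup>+\<omega>. ennreal (W \<omega>) \<partial>M) = 1"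
    using W_pos W_mean by (subst nn_integral_eq_integral[OF W_integrable]) auto
  define P where "P \<omega> = (\<Prod>j<m. G j (Wf (j, p 0 j) \<omega>))" for \<omega>
  define Q where "Q l \<omega> = (\<Prod>j<m + r. G j (Wf (j, p l j) \<omega>))" for l \<omega>
  have GW: "(\<integral>\<^sup>+\<omega>. G j (W \<omega>) \<partial>M) = (if j < m then \<mu> else 1)" for j
    unfolding G_def \<mu>_def using W1 by simp
  have EP: "(\<integral>\<^sup>+\<omega>. P \<omega> \<partial>M) = \<mu> ^ m"
    unfolding P_def by (subst nn_integral_prod_path) (auto intro!: p_less G simp: GW)
  have EQ: "(\<integral>\<^sup>+\<omega>. Q l \<omega> \<partial>M) = \<mu> ^ m" if "l < 2 ^ r" for l
  proof -
    have "(\<integral>\<^sup>+\<omega>. Q l \<omega> \<partial>M) = (\<Prod>j<m + r. if j < m then \<mu> else 1)"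
      unfolding Q_def using that by (subst nn_integral_prod_path) (auto intro!: p_less G simp: GW)
    also have "\<dots> = (\<Prod>j<m. \<mu>)"
      by (rule prod.mono_neutral_cong_right) auto
    finally show ?thesis by simp
  qed
  have [measurable]: "P \<in> borel_measurable M"
    unfolding P_def by (intro borel_measurable_prod_ennreal measurable_compose[OF Wf_measurable G] p_less) auto
  have [measurable]: "Q l \<in> borel_measurable M" if "l < 2 ^ r" for l
    unfolding Q_def using that
    by (intro borel_measurable_prod_ennreal measurable_compose[OF Wf_measurable G] p_less) auto
  have bound: "ennreal (cell_mass Wf m k r \<omega> powr s)
      \<le> ennreal c * (ennreal (1 - s) * P \<omega> + ennreal (s / 2 ^ r) * (\<Sum>l<2 ^ r. Q l \<omega>))"
    if pos: "\<forall>n k. k < 2 ^ n \<longrightarrow> 0 < Wf (n, k) \<omega>" for \<omega>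
  proof -
    define A where "A = (\<Prod>j<m. Wf (j, p 0 j) \<omega>)"
    define Z where "Z l = (\<Prod>j\<in>{m..<m + r}. Wf (j, p l j) \<omega>)" for l
    have A: "0 < A" unfolding A_def using pos p_less by (intro prod_pos) auto
    have Z: "0 \<le> Z l" if "l < 2 ^ r" for l
      unfolding Z_def using pos p_less that by (intro prod_nonneg) (auto intro!: less_imp_le)
    have split: "{..<m + r} = {..<m} \<union> {m..<m + r}" by auto
    have prod_split: "(\<Prod>j<m + r. h j) = (\<Prod>j<m. h j) * (\<Prod>j\<in>{m..<m + r}. h j)"
      for h :: "nat \<Rightarrow> 'c::comm_monoid_mult"
      unfolding split by (rule prod.union_disjoint) auto
    have path: "(\<Prod>j<m + r. Wf (j, p l j) \<omega>) = A * Z l" if "l < 2 ^ r" for l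
      unfolding prod_split A_def Z_def using p_anc[OF that] by simp
    define avg where "avg = (\<Sum>l<2 ^ r. Z l) / 2 ^ r"
    have avg: "0 \<le> avg" unfolding avg_def using Z by (intro divide_nonneg_nonneg sum_nonneg) auto
    have As: "P \<omega> = ennreal (A powr s)"
      unfolding P_def A_def G_def using pos p_less
      by (simp add: prod_ennreal prod_powr_distrib[symmetric] less_imp_le)
    have Qs: "Q l \<omega> = ennreal (A powr s * Z l)" if "l < 2 ^ r" for l
    proof -
      have "Q l \<omega> = P \<omega> * (\<Prod>j\<in>{m..<m + r}. ennreal (Wf (j, p l j) \<omega>))"
        unfolding Q_def prod_split P_def using p_anc[OF that] by (simp add: G_def)
      also have "(\<Prod>j\<in>{m..<m + r}. ennreal (Wf (j, p l j) \<omega>)) = ennreal (Z l)"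
        unfolding Z_def using pos p_less that by (intro prod_ennreal) (auto intro!: less_imp_le)
      finally show ?thesis using As Z[OF that] by (simp add: ennreal_mult)
    qed
    have "cell_mass Wf m k r \<omega> = (\<Sum>l<2 ^ r. A * Z l) / 2 ^ (m + r)"
      unfolding cell_mass_def p_def[symmetric] using path by simp
    also have "\<dots> = (1/2) ^ m * (A * avg)"
      unfolding avg_def by (simp add: power_add power_one_over field_simps flip: sum_distrib_left)
    finally have "cell_mass Wf m k r \<omega> powr s = c * (A powr s * avg powr s)"
      unfolding c_def using A avg by (simp add: powr_mult)
    \<comment> \<open>Linearising here leaves only products along single branches, whose factors are independent.\<close>
    also have "\<dots> \<le> c * (A powr s * (1 - s + s * avg))"
      using powr_le_affine[OF avg, of s] s unfolding c_def by (intro mult_left_mono) auto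
    also have "\<dots> = c * ((1 - s) * A powr s + s / 2 ^ r * (\<Sum>l<2 ^ r. A powr s * Z l))"
      unfolding avg_def sum_distrib_left[symmetric] by (simp add: field_simps)
    finally have "ennreal (cell_mass Wf m k r \<omega> powr s)
        \<le> ennreal (c * ((1 - s) * A powr s + s / 2 ^ r * (\<Sum>l<2 ^ r. A powr s * Z l)))"
      by (rule ennreal_leI)
    also have "\<dots> = ennreal c * (ennreal (1 - s) * ennreal (A powr s)
        + ennreal (s / 2 ^ r) * ennreal (\<Sum>l<2 ^ r. A powr s * Z l))"
    proof -
      have S: "0 \<le> (\<Sum>l<2 ^ r. A powr s * Z l)" using Z by (intro sum_nonneg) auto
      have distr: "ennreal (c * (a * b + d * e)) = ennreal c * (ennreal a * ennreal b + ennreal d * ennreal e)"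
        if "0 \<le> a" "0 \<le> b" "0 \<le> d" "0 \<le> e" for a b d e
        using that unfolding c_def by (simp add: ennreal_mult)
      show ?thesis by (rule distr) (use s S in auto)
    qed
    also have "ennreal (\<Sum>l<2 ^ r. A powr s * Z l) = (\<Sum>l<2 ^ r. Q l \<omega>)"
      using Z by (subst sum_ennreal[symmetric]) (auto simp: Qs)
    finally show ?thesis using As by simp
  qed
  have "(\<integral>\<^sup>+\<omega>. ennreal (cell_mass Wf m k r \<omega> powr s) \<partial>M)
      \<le> (\<integral>\<^sup>+\<omega>. ennreal c * (ennreal (1 - s) * P \<omega> + ennreal (s / 2 ^ r) * (\<Sum>l<2 ^ r. Q l \<omega>)) \<partial>M)"
    using AE_Wf_pos by (intro nn_integral_mono_AE) (auto elim!: eventually_mono intro: bound)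
  also have "\<dots> = ennreal c * (ennreal (1 - s) * \<mu> ^ m + ennreal (s / 2 ^ r) * (\<Sum>l\<in>{..<2 ^ r :: nat}. \<mu> ^ m))"
  proof -
    have "(\<integral>\<^sup>+\<omega>. (\<Sum>l<2 ^ r. Q l \<omega>) \<partial>M) = (\<Sum>l\<in>{..<2 ^ r :: nat}. \<mu> ^ m)"
      using EQ by (subst nn_integral_sum) auto
    then show ?thesis using EP by (simp add: nn_integral_cmult nn_integral_add)
  qed
  also have "\<dots> = ennreal c * ((ennreal (1 - s) + ennreal (s / 2 ^ r) * ennreal (2 ^ r)) * \<mu> ^ m)"
    by (simp add: distrib_right mult.assoc ennreal_power[symmetric])
  \<comment> \<open>The weights of the tangent line add up to 1, and \<open>r\<close> drops
    out.\<close>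
  also have "ennreal (1 - s) + ennreal (s / 2 ^ r) * ennreal (2 ^ r) = 1"
    using s by (simp add: ennreal_mult[symmetric] ennreal_plus[symmetric] del: ennreal_plus)
  finally show ?thesis unfolding c_def \<mu>_def by simp
qed

text \<open>\<open>moment\<close> says \<open>t \<le> \<phi>(s)\<close>. Deterministic covers of
  Euclidean cost below \<open>e p\<close> yield random costs \<open>C p\<close> with expectation of
  order \<open>e p\<close>, so their infimum is almost surely 0. As \<open>C p\<close> does not
  mention \<open>\<nu>\<close>, one exceptional set serves every \<open>\<nu>\<close>.\<close>

lemma AE_hausdorff_measure_null:
  assumes K: "K \<subseteq> {0..1}" "K \<noteq> {}" and s: "0 < s" "s \<le> 1"
    and t: "0 \<le> t" "hausdorff_measure dist t K = 0"
    and moment: "(\<integral>\<^sup>+\<omega>. ennreal (W \<omega> powr s) \<partial>M) \<le> ennreal (2 powr (s - t))"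
  shows "AE \<omega> in M. \<forall>\<nu>. cascade_limit Wf \<omega> \<nu> \<longrightarrow> hausdorff_measure (cascade_metric \<nu>) s K = 0"
proof -
  have t_pos: "0 < t"
    using t hausdorff_measure_zero_pos[OF K(2), of dist] by (cases "t = 0") auto
  define e where "e p = (1/2::real) ^ p" for p :: nat
  have e_pos: "0 < e p" for p unfolding e_def by simp
  \<comment> \<open>The mesh bound 1 is arbitrary: diameters in the cascade metric will be
    controlled by the total cost.\<close>
  have "\<exists>U :: nat \<Rightarrow> real set. K \<subseteq> (\<Union>i. U i) \<and> (\<forall>i. U i \<subseteq> {0..1}) \<and>
      (\<Sum>i. ennreal (cover_cost dist t (U i))) < ennreal (e p)" for p
    using hausdorff_null_coverE[OF t(2), of 1 "ennreal (e p)"] e_pos by (metis ennreal_less_zero_iff zero_less_one)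
  then obtain U :: "nat \<Rightarrow> nat \<Rightarrow> real set" where cover: "\<And>p. K \<subseteq> (\<Union>i. U p i)"
    and U01: "\<And>p i. U p i \<subseteq> {0..1}"
    and costU: "\<And>p. (\<Sum>i. ennreal (cover_cost dist t (U p i))) < ennreal (e p)"
    by metis
  \<comment> \<open>The slacks \<open>e p * (1/2) ^ Suc i\<close> sum to \<open>e p\<close> over
    \<open>i\<close>.\<close>
  have "\<exists>m k. k < 2 ^ m \<and> (\<forall>x\<in>U p i. \<bar>x * 2 ^ m - real k - 1/2\<bar> \<le> 3/2) \<and>
      ((1/2) ^ m) powr t \<le> 2 powr t * cover_cost dist t (U p i) + e p * (1/2) ^ Suc i" for p i
    using e_pos by (intro exists_dyadic_location U01 t_pos) simp
  then obtain m k :: "nat \<Rightarrow> nat \<Rightarrow> nat" where k: "\<And>p i. k p i < 2 ^ m p i"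
    and loc: "\<And>p i x. x \<in> U p i \<Longrightarrow> \<bar>x * 2 ^ m p i - real (k p i) - 1/2\<bar> \<le> 3/2"
    and scale: "\<And>p i. ((1/2) ^ m p i) powr t
      \<le> 2 powr t * cover_cost dist t (U p i) + e p * (1/2) ^ Suc i"
    by metis
  define Y where "Y p i r \<omega> =
    (\<Sum>j\<in>neighbours (m p i) (k p i). ennreal (cell_mass Wf (m p i) j r \<omega> powr s))" for p i r \<omega>
  define C where "C p \<omega> = (\<Sum>i. liminf (\<lambda>r. Y p i r \<omega>))" for p \<omega>
  have Y_meas [measurable]: "Y p i r \<in> borel_measurable M" for p i r
    unfolding Y_def
    by (intro borel_measurable_sum measurable_compose[OF _ measurable_ennreal]
        powr_real_measurable cell_mass_measurable borel_measurable_const)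
       (auto simp: neighbours_def)
  have C_meas [measurable]: "C p \<in> borel_measurable M" for p unfolding C_def by measurable
  have cell: "(\<integral>\<^sup>+\<omega>. ennreal (cell_mass Wf n j r \<omega> powr s) \<partial>M) \<le> ennreal (((1/2) ^ n) powr t)"
    if "j < 2 ^ n" for n j r
  proof -
    have "(\<integral>\<^sup>+\<omega>. ennreal (cell_mass Wf n j r \<omega> powr s) \<partial>M)
        \<le> ennreal (((1/2) ^ n) powr s) * (\<integral>\<^sup>+\<omega>. ennreal (W \<omega> powr s) \<partial>M) ^ n"
      by (rule nn_integral_cell_mass_powr_le[OF that s])
    also have "\<dots> \<le> ennreal (((1/2) ^ n) powr s) * ennreal (2 powr (s - t)) ^ n"
      by (intro mult_left_mono power_mono moment) auto
    also have "\<dots> = ennreal (((1/2) ^ n) powr s * (2 powr (s - t)) ^ n)"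
      by (simp add: ennreal_power ennreal_mult)
    \<comment> \<open>The exponents of 2 are \<open>- n * s\<close> and \<open>n * (s - t)\<close>;
      their sum \<open>- n * t\<close> is free of \<open>s\<close>.\<close>
    also have "((1/2::real) ^ n) powr s * (2 powr (s - t)) ^ n = ((1/2) ^ n) powr t"
    proof -
      have half: "((1/2::real) ^ n) powr x = 2 powr (- (real n * x))" for x
        by (simp add: powr_minus power_one_over powr_divide powr_powr flip: powr_realpow)
           (simp add: powr_minus divide_simps)
      have "(2 powr (s - t)) ^ n = (2::real) powr (real n * (s - t))"
        by (simp add: powr_powr mult.commute flip: powr_realpow)
      then show ?thesis unfolding half by (simp add: algebra_simps flip: powr_add)
    qed
    finally show ?thesis .
  qed
  have EY: "(\<integral>\<^sup>+\<omega>. Y p i r \<omega> \<partial>M) \<le> 5 * ennreal (((1/2) ^ m p i) powr t)" for p i r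
  proof -
    let ?N = "neighbours (m p i) (k p i)"
    have "(\<integral>\<^sup>+\<omega>. Y p i r \<omega> \<partial>M)
        = (\<Sum>j\<in>?N. \<integral>\<^sup>+\<omega>. ennreal (cell_mass Wf (m p i) j r \<omega> powr s) \<partial>M)"
      unfolding Y_def
      by (intro nn_integral_sum measurable_compose[OF _ measurable_ennreal]
        powr_real_measurable cell_mass_measurable borel_measurable_const)
       (auto simp: neighbours_def)
    also have "\<dots> \<le> (\<Sum>j\<in>?N. ennreal (((1/2) ^ m p i) powr t))"
      by (intro sum_mono cell) (auto simp: neighbours_def)
    also have "\<dots> = of_nat (card ?N) * ennreal (((1/2) ^ m p i) powr t)" by simp
    also have "\<dots> \<le> of_nat 5 * ennreal (((1/2) ^ m p i) powr t)"
      using card_neighbours_le by (intro mult_right_mono of_nat_mono) auto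
    finally show ?thesis by simp
  qed
  \<comment> \<open>The 5 counts neighbouring cells, \<open>2 powr t\<close> stems from rounding to
    a dyadic scale, and the 1 from the slacks.\<close>
  have EC: "(\<integral>\<^sup>+\<omega>. C p \<omega> \<partial>M) \<le> ennreal (5 * (2 powr t + 1) * e p)" for p
  proof -
    have "(\<integral>\<^sup>+\<omega>. C p \<omega> \<partial>M) = (\<Sum>i. \<integral>\<^sup>+\<omega>. liminf (\<lambda>r. Y p i r \<omega>) \<partial>M)"
      unfolding C_def by (rule nn_integral_suminf) measurable
    also have "\<dots> \<le> (\<Sum>i. 5 * (ennreal (2 powr t) * ennreal (cover_cost dist t (U p i))
        + ennreal (e p * (1/2) ^ Suc i)))"
    proof (intro suminf_le summableI)
      fix i
      have "(\<integral>\<^sup>+\<omega>. liminf (\<lambda>r. Y p i r \<omega>) \<partial>M) \<le> liminf (\<lambda>r. \<integral>\<^sup>+\<omega>. Y p i r \<omega> \<partial>M)"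
        by (rule nn_integral_liminf) measurable
      also have "\<dots> \<le> 5 * ennreal (((1/2) ^ m p i) powr t)"
        using Liminf_mono[OF always_eventually[OF allI[OF EY[of p i]]], of sequentially]
        by (simp add: Liminf_const)
      also have "\<dots> \<le> 5 * ennreal (2 powr t * cover_cost dist t (U p i) + e p * (1/2) ^ Suc i)"
        by (intro mult_left_mono ennreal_leI scale) simp
      also have "\<dots> = 5 * (ennreal (2 powr t) * ennreal (cover_cost dist t (U p i))
          + ennreal (e p * (1/2) ^ Suc i))"
        using e_pos[of p] t_pos by (simp add: ennreal_mult cover_cost_eq_powr)
      finally show "(\<integral>\<^sup>+\<omega>. liminf (\<lambda>r. Y p i r \<omega>) \<partial>M) \<le> \<dots>" .
    qed
    also have "\<dots> = 5 * (ennreal (2 powr t) * (\<Sum>i. ennreal (cover_cost dist t (U p i)))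
        + (\<Sum>i. ennreal (e p * (1/2) ^ Suc i)))"
      by (simp only: ennreal_suminf_cmult suminf_add[symmetric, OF summableI summableI])
    also have "(\<Sum>i. ennreal (e p * (1/2) ^ Suc i)) = ennreal (e p)"
    proof -
      have "(\<lambda>i. e p * (1/2) ^ Suc i) sums (e p * 1)"
        by (intro sums_mult power_half_series)
      then show ?thesis
        using e_pos[of p] by (subst suminf_ennreal2) (auto simp: sums_iff)
    qed
    also have "5 * (ennreal (2 powr t) * (\<Sum>i. ennreal (cover_cost dist t (U p i))) + ennreal (e p))
        \<le> 5 * (ennreal (2 powr t) * ennreal (e p) + ennreal (e p))"
      using costU[of p] by (intro mult_left_mono add_right_mono) auto
    also have "\<dots> = ennreal (5 * (2 powr t + 1) * e p)"
      using e_pos[of p]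
      by (simp add: ennreal_mult ennreal_numeral[symmetric] algebra_simps del: ennreal_numeral)
    finally show ?thesis .
  qed
  have "(\<integral>\<^sup>+\<omega>. (INF p. C p \<omega>) \<partial>M) \<le> 0"
  proof (rule LIMSEQ_le_const)
    have "(\<lambda>p. ennreal (5 * (2 powr t + 1) * e p)) \<longlonglongrightarrow> ennreal (5 * (2 powr t + 1) * 0)"
      unfolding e_def by (intro tendsto_ennrealI tendsto_mult tendsto_const LIMSEQ_power_zero) simp
    then show "(\<lambda>p. ennreal (5 * (2 powr t + 1) * e p)) \<longlonglongrightarrow> 0" by simp
    have "(\<integral>\<^sup>+\<omega>. (INF p. C p \<omega>) \<partial>M) \<le> (\<integral>\<^sup>+\<omega>. C p \<omega> \<partial>M)" for p
      by (intro nn_integral_mono INF_lower) simp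
    then show "\<exists>N. \<forall>p\<ge>N. (\<integral>\<^sup>+\<omega>. (INF p. C p \<omega>) \<partial>M) \<le> ennreal (5 * (2 powr t + 1) * e p)"
      using EC order_trans by blast
  qed
  then have "(\<integral>\<^sup>+\<omega>. (INF p. C p \<omega>) \<partial>M) = 0" by simp
  then have "AE \<omega> in M. (INF p. C p \<omega>) = 0"
    by (subst (asm) nn_integral_0_iff_AE) measurable
  with AE_Wf_pos show ?thesis
  proof eventually_elim
    case (elim \<omega>)
    show ?case
    proof (intro allI impI hausdorff_measure_eq_0I)
      fix \<nu> and \<delta> \<epsilon> :: real
      assume lim: "cascade_limit Wf \<omega> \<nu>" and \<delta>: "0 < \<delta>" and \<epsilon>: "0 < \<epsilon>"
      \<comment> \<open>The bound \<open>\<epsilon>\<close> controls the total cost;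
        \<open>\<delta> powr s\<close> bounds each single term and thus forces every diameter to be
        at most \<open>\<delta>\<close>.\<close>
      have "(INF p. C p \<omega>) < ennreal (min \<epsilon> (\<delta> powr s))" using elim \<delta> \<epsilon> by simp
      then obtain p where p: "C p \<omega> < ennreal (min \<epsilon> (\<delta> powr s))" by (auto simp: INF_less_iff)
      have diam_le: "ennreal (sdiam (cascade_metric \<nu>) (U p i) powr s) \<le> liminf (\<lambda>r. Y p i r \<omega>)" for i
        unfolding Y_def using elim(1) loc U01 s
        by (intro sdiam_cascade_metric_powr_le[OF lim]) auto
      have "sdiam (cascade_metric \<nu>) (U p i) \<le> \<delta>" for i
      proof (rule ccontr)
        assume "\<not> ?thesis"
        then have "\<delta> powr s \<le> sdiam (cascade_metric \<nu>) (U p i) powr s"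
          using \<delta> s by (intro powr_mono2) auto
        then have "ennreal (\<delta> powr s) \<le> liminf (\<lambda>r. Y p i r \<omega>)"
          using diam_le[of i] order_trans ennreal_leI by blast
        also have "\<dots> = (\<Sum>i\<in>{i}. liminf (\<lambda>r. Y p i r \<omega>))" by simp
        also have "\<dots> \<le> C p \<omega>" unfolding C_def by (intro sum_le_suminf) auto
        also note p
        finally show False by (simp add: ennreal_less_iff)
      qed
      moreover have "(\<Sum>i. ennreal (cover_cost (cascade_metric \<nu>) s (U p i))) \<le> ennreal \<epsilon>"
      proof -
        have "(\<Sum>i. ennreal (cover_cost (cascade_metric \<nu>) s (U p i))) \<le> C p \<omega>"
          unfolding C_def using diam_le s
          by (intro suminf_le summableI) (simp add: cover_cost_eq_powr)
        also have "\<dots> \<le> ennreal \<epsilon>"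
          by (rule order_trans[OF less_imp_le[OF p] ennreal_leI]) simp
        finally show ?thesis .
      qed
      ultimately show "\<exists>U :: nat \<Rightarrow> real set. K \<subseteq> (\<Union>i. U i) \<and>
          (\<forall>i. U i \<subseteq> {0..1} \<and> sdiam (cascade_metric \<nu>) (U i) \<le> \<delta>) \<and>
          (\<Sum>i. ennreal (cover_cost (cascade_metric \<nu>) s (U i))) \<le> ennreal \<epsilon>"
        using cover[of p] U01 by (intro exI[of _ "U p"]) auto
    qed
  qed
qed

section \<open>Moments with exponent in \<open>[0, 1]\<close> and left continuity of
  \<open>\<phi>\<close>\<close>

lemma W_powr_le: "AE \<omega> in M. norm (W \<omega> powr x) \<le> 1 + W \<omega>" if "0 \<le> x" "x \<le> 1"
  using W_pos
proof eventually_elim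
  case (elim \<omega>)
  have "W \<omega> powr x \<le> 1 - x + x * W \<omega>" using elim that by (intro powr_le_affine) auto
  also have "\<dots> \<le> 1 + W \<omega>"
    using that mult_left_le_one_le[OF less_imp_le[OF elim] that] by linarith
  finally show ?case by simp
qed

lemma W_powr_integrable: "integrable M (\<lambda>\<omega>. W \<omega> powr x)" if "0 \<le> x" "x \<le> 1"
proof (rule Bochner_Integration.integrable_bound)
  show "integrable M (\<lambda>\<omega>. 1 + W \<omega>)" using W_integrable by simp
  show "AE \<omega> in M. norm (W \<omega> powr x) \<le> norm (1 + W \<omega>)"
    using W_powr_le[OF that] by eventually_elim auto
qed simp

lemma nn_integral_W_powr:
  assumes "0 \<le> x" "x \<le> 1"
  shows "(\<integral>\<^sup>+\<omega>. ennreal (W \<omega> powr x) \<partial>M) = ennreal (expectation (\<lambda>\<omega>. W \<omega> powr x))"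
  using assms by (intro nn_integral_eq_integral W_powr_integrable) auto

lemma expectation_W_powr_pos:
  assumes "0 \<le> x" "x \<le> 1"
  shows "0 < expectation (\<lambda>\<omega>. W \<omega> powr x)"
proof -
  have "expectation (\<lambda>\<omega>. W \<omega> powr x) \<noteq> 0"
  proof
    assume "expectation (\<lambda>\<omega>. W \<omega> powr x) = 0"
    then have "AE \<omega> in M. W \<omega> powr x = 0"
      using assms by (subst (asm) integral_nonneg_eq_0_iff_AE) (auto intro: W_powr_integrable)
    with W_pos have "AE \<omega> in M. False" by eventually_elim auto
    then show False by simp
  qed
  moreover have "0 \<le> expectation (\<lambda>\<omega>. W \<omega> powr x)" by (intro integral_nonneg_AE) auto
  ultimately show ?thesis by linarith
qed

text \<open>These moments are finite and positive, so the value \<open>-\<infinity>\<close> does not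
  occur and the logarithm is genuine.\<close>

lemma cascade_phi_eq:
  assumes "0 \<le> x" "x \<le> 1"
  shows "cascade_phi M W x = ereal (x - log 2 (expectation (\<lambda>\<omega>. W \<omega> powr x)))"
  unfolding cascade_phi_def nn_integral_W_powr[OF assms]
  using expectation_W_powr_pos[OF assms] by (simp add: Let_def)

text \<open>Dominated convergence with the majorant \<open>1 + W\<close>, common to all exponents in
  \<open>[0, 1]\<close>. Approach from the left stays in that range even for
  \<open>x = 1\<close>.\<close>

lemma expectation_W_powr_tendsto:
  assumes "0 < x" "x \<le> 1"
  shows "((\<lambda>y. expectation (\<lambda>\<omega>. W \<omega> powr y)) \<longlongrightarrow> expectation (\<lambda>\<omega>. W \<omega> powr x)) (at_left x)"
proof (rule tendsto_at_left_sequentially[OF assms(1)])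
  fix S :: "nat \<Rightarrow> real" assume S: "\<And>n. S n < x" "\<And>n. 0 < S n" "S \<longlonglongrightarrow> x"
  show "(\<lambda>n. expectation (\<lambda>\<omega>. W \<omega> powr S n)) \<longlonglongrightarrow> expectation (\<lambda>\<omega>. W \<omega> powr x)"
  proof (rule integral_dominated_convergence[where w = "\<lambda>\<omega>. 1 + W \<omega>"])
    show "integrable M (\<lambda>\<omega>. 1 + W \<omega>)" using W_integrable by simp
    show "AE \<omega> in M. (\<lambda>n. W \<omega> powr S n) \<longlonglongrightarrow> W \<omega> powr x"
      using W_pos by eventually_elim (auto intro!: tendsto_powr S)
    show "AE \<omega> in M. norm (W \<omega> powr S n) \<le> 1 + W \<omega>" for n
      using S(1)[of n] S(2)[of n] assms by (intro W_powr_le) auto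
  qed auto
qed

text \<open>Left continuity preserves \<open>t < \<phi>(q)\<close> for \<open>q\<close> slightly
  below \<open>x\<close>. Rationality of \<open>q\<close> allows countably many null sets to be
  merged.\<close>

lemma exists_rat_moment:
  assumes x: "0 < x" "x \<le> 1" and t: "ereal t < cascade_phi M W x"
  obtains q where "q \<in> \<rat>" "0 < q" "q < x"
    "(\<integral>\<^sup>+\<omega>. ennreal (W \<omega> powr q) \<partial>M) \<le> ennreal (2 powr (q - t))"
proof -
  let ?m = "\<lambda>y. expectation (\<lambda>\<omega>. W \<omega> powr y)"
  have "((\<lambda>y. y - log 2 (?m y)) \<longlongrightarrow> x - log 2 (?m x)) (at_left x)"
    using x expectation_W_powr_pos[of x]
    by (intro tendsto_intros expectation_W_powr_tendsto) auto
  moreover have "t < x - log 2 (?m x)" using t x by (simp add: cascade_phi_eq)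
  ultimately have "\<forall>\<^sub>F y in at_left x. t < y - log 2 (?m y)" by (rule order_tendstoD)
  then obtain b where b: "b < x" "\<And>y. b < y \<Longrightarrow> y < x \<Longrightarrow> t < y - log 2 (?m y)"
    unfolding eventually_at_left_field by blast
  obtain q where q: "q \<in> \<rat>" "max 0 b < q" "q < x"
    using Rats_dense_in_real[of "max 0 b" x] b(1) x(1) by auto
  have "log 2 (?m q) < q - t" using b(2)[of q] q by simp
  then have "?m q < 2 powr (q - t)"
    using expectation_W_powr_pos[of q] q x by (simp add: log_less_iff)
  then show ?thesis using q x that[of q] by (simp add: nn_integral_W_powr ennreal_leI)
qed

end

theorem theorem3p4:
  fixes M :: "'a measure" and W :: "'a \<Rightarrow> real"
    and Wf :: "nat \<times> nat \<Rightarrow> 'a \<Rightarrow> real" and K :: "real set"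
  assumes "prob_space M"
    and "W \<in> borel_measurable M"
    and "prob_space.indep_vars M (\<lambda>_. borel) Wf {(n, k). k < 2 ^ n}"
    and "\<And>n k. k < 2 ^ n \<Longrightarrow> distr M borel (Wf (n, k)) = distr M borel W"
    and "AE \<omega> in M. W \<omega> > 0"
    and "integrable M W" and "(\<integral>\<omega>. W \<omega> \<partial>M) = 1"
    and "integrable M (\<lambda>\<omega>. W \<omega> * log 2 (W \<omega>))"
    and "(\<integral>\<omega>. W \<omega> * log 2 (W \<omega>) \<partial>M) < 1"
    and "K \<subseteq> {0..1}" and "K \<noteq> {}"
  shows "AE \<omega> in M. \<forall>\<nu>. cascade_limit Wf \<omega> \<nu> \<longrightarrow>
           (\<forall>\<zeta>. hausdorff_dim (cascade_metric \<nu>) K = ereal \<zeta> \<longrightarrow>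
                cascade_phi M W \<zeta> \<le> hausdorff_dim dist K)"
proof -
  interpret mandelbrot_cascade M W Wf
    using assms by (intro mandelbrot_cascade.intro mandelbrot_cascade_axioms.intro)
  let ?good = "\<lambda>q. 0 < q \<and> q \<le> 1 \<and> (\<exists>t\<ge>0. hausdorff_measure dist t K = 0 \<and>
    (\<integral>\<^sup>+\<omega>. ennreal (W \<omega> powr q) \<partial>M) \<le> ennreal (2 powr (q - t)))"
  \<comment> \<open>The dimension \<open>\<zeta>\<close> is random, so the null set must be fixed
    before an exponent is chosen. \<open>?good q\<close> is deterministic, hence can be decided
    outside the almost-sure statement.\<close>
  have "AE \<omega> in M. \<forall>q\<in>\<rat>. ?good q \<longrightarrow>
      (\<forall>\<nu>. cascade_limit Wf \<omega> \<nu> \<longrightarrow> hausdorff_measure (cascade_metric \<nu>) q K = 0)"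
  proof (rule AE_ball_countable')
    fix q :: real
    show "AE \<omega> in M. ?good q \<longrightarrow>
      (\<forall>\<nu>. cascade_limit Wf \<omega> \<nu> \<longrightarrow> hausdorff_measure (cascade_metric \<nu>) q K = 0)"
    proof (cases "?good q")
      case True
      then obtain t where "0 \<le> t" "hausdorff_measure dist t K = 0"
        "(\<integral>\<^sup>+\<omega>. ennreal (W \<omega> powr q) \<partial>M) \<le> ennreal (2 powr (q - t))" by blast
      then show ?thesis
        using AE_hausdorff_measure_null[OF assms(10,11), of q t] True by auto
    qed auto
  qed (rule countable_rat)
  then show ?thesis
  proof eventually_elim
    case (elim \<omega>)
    show ?case
    proof (intro allI impI)
      fix \<nu> \<zeta>
      assume lim: "cascade_limit Wf \<omega> \<nu>" and \<zeta>: "hausdorff_dim (cascade_metric \<nu>) K = ereal \<zeta>"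
      have "finite_measure \<nu>" "sets \<nu> = sets borel" using lim unfolding cascade_limit_def by auto
      note bounds = hausdorff_dim_bounds[OF this assms(10) \<zeta>]
      show "cascade_phi M W \<zeta> \<le> hausdorff_dim dist K"
      proof (rule ccontr)
        assume "\<not> ?thesis"
        then have "hausdorff_dim dist K < cascade_phi M W \<zeta>" by simp
        then obtain t where t: "0 \<le> t" "hausdorff_measure dist t K = 0" "ereal t < cascade_phi M W \<zeta>"
          unfolding hausdorff_dim_def Inf_less_iff by auto
        \<comment> \<open>Here \<open>\<phi>(0) = 0\<close>, which contradicts
          \<open>0 \<le> t < \<phi>(\<zeta>)\<close>. Positivity of \<open>W\<close> enters because
          \<open>0 powr 0\<close> is 0, not 1.\<close>
        have "\<zeta> \<noteq> 0"
        proof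
          assume "\<zeta> = 0"
          moreover have "AE x in M. W x powr 0 = 1" using W_pos by eventually_elim simp
          then have "expectation (\<lambda>x. W x powr 0) = expectation (\<lambda>x. 1)"
            by (intro integral_cong_AE) auto
          ultimately show False using t cascade_phi_eq[of 0] by (simp add: prob_space)
        qed
        then have "0 < \<zeta>" using bounds by simp
        then obtain q where q: "q \<in> \<rat>" "0 < q" "q < \<zeta>"
          "(\<integral>\<^sup>+\<omega>. ennreal (W \<omega> powr q) \<partial>M) \<le> ennreal (2 powr (q - t))"
          using exists_rat_moment[OF _ bounds(2) t(3)] by blast
        then have "?good q" using bounds t by auto
        then have "hausdorff_measure (cascade_metric \<nu>) q K = 0" using elim q(1) lim by blast
        then show False using hausdorff_dim_le[of q "cascade_metric \<nu>" K] q \<zeta> by simp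
      qed
    qed
  qed
qed

end
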